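(* Let $\mathcal{H}$ be a complex Hilbert space, let $A\in\mathcal{B}(\mathcal{H})$ be a positive operator, and let $T,X,Y\in\mathcal{B}_A(\mathcal{H})$. Then, for each choice of the sign $\pm$, (i) $$w_A(TX\pm YT)\leq 2\sqrt{2}\,\max\{\|X\|_A,\|Y\|_A\}\sqrt{w_A^2(T)-\frac{\big|\,\|\Re_A(T)\|_A^2-\|\Im_A(T)\|_A^2\,\big|}{2}},$$ and (ii) $$w_A(TX\pm YT)\leq 2\sqrt{2}\,\max\{\|X\|_A,\|Y\|_A\}\sqrt{w_A^2(T)-\frac{\big|\,\|\Re_A(T)+\Im_A(T)\|_A^2-\|\Re_A(T)-\Im_A(T)\|_A^2\,\big|}{4}}.$$
   Context: $\mathcal{B}(\mathcal{H})$ is the algebra of bounded linear operators on the complex Hilbert space $\mathcal{H}$ with inner product $\langle\cdot,\cdot\rangle$; $A\in\mathcal{B}(\mathcal{H})$ is positive (i.e. $\langle Ax,x\rangle\ge 0$ for all $x$), not necessarily injective. Put $\langle x,y\rangle_A=\langle Ax,y\rangle$ and $\|x\|_A=\sqrt{\langle x,x\rangle_A}$ (a seminorm on $\mathcal{H}$). $R(S)$ denotes the range of $S$ and $\overline{R(S)}$ its norm closure. $\mathcal{B}_A(\mathcal{H})=\{T\in\mathcal{B}(\mathcal{H}): R(T^*A)\subseteq R(A)\}$, equivalently the set of $T\in\mathcal{B}(\mathcal{H})$ for which there is $S\in\mathcal{B}(\mathcal{H})$ with $AS=T^*A$; it is a subalgebra of $\mathcal{B}(\mathcal{H})$. For $T\in\mathcal{B}_A(\mathcal{H})$,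 $T^{\sharp_A}$ denotes the unique $X\in\mathcal{B}(\mathcal{H})$ with $AX=T^*A$ and $R(X)\subseteq\overline{R(A)}$. For $T\in\mathcal{B}_A(\mathcal{H})$: $\|T\|_A=\sup\{\|Tx\|_A: x\in\overline{R(A)},\ \|x\|_A=1\}=\sup\{\|Tx\|_A: x\in\mathcal{H},\ \|x\|_A=1\}$ (finite), and $w_A(T)=\sup\{|\langle Tx,x\rangle_A|: x\in\mathcal{H},\ \|x\|_A=1\}$; $w_A^2(T)$ means $(w_A(T))^2$. Finally $\Re_A(T)=\frac{T+T^{\sharp_A}}{2}$ and $\Im_A(T)=\frac{T-T^{\sharp_A}}{2\mathrm{i}}$. *)

theory Defs
  imports "HOL-Analysis.Analysis"
begin

text \<open>
  A complex inner product space carries its underlying real inner product space: the real inner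
  product is the real part of the complex one, so that norm, topology and positive definiteness
  are those of the class \<^class>\<open>real_inner\<close>. The complex inner product is linear in its first
  argument and conjugate-linear in its second.
\<close>

class complex_inner = real_inner +
  fixes scaleC :: "complex \<Rightarrow> 'a \<Rightarrow> 'a"  (infixr "*\<^sub>C" 75)
    and cinner :: "'a \<Rightarrow> 'a \<Rightarrow> complex"
  assumes scaleC_add_right: "c *\<^sub>C (x + y) = c *\<^sub>C x + c *\<^sub>C y"
    and scaleC_add_left: "(c + d) *\<^sub>C x = c *\<^sub>C x + d *\<^sub>C x"
    and scaleC_scaleC: "c *\<^sub>C (d *\<^sub>C x) = (c * d) *\<^sub>C x"
    and scaleC_of_real: "complex_of_real r *\<^sub>C x = r *\<^sub>R x"
    and cinner_add_left: "cinner (x + y) z = cinner x z + cinner y z"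
    and cinner_scaleC_left: "cinner (c *\<^sub>C x) y = c * cinner x y"
    and cinner_commute: "cinner x y = cnj (cinner y x)"
    and inner_eq_Re_cinner: "inner x y = Re (cinner x y)"

class chilbert_space = complex_inner + complete_space

definition bounded_clinear :: "('a::complex_inner \<Rightarrow> 'a) \<Rightarrow> bool" where
  "bounded_clinear T \<longleftrightarrow> bounded_linear T \<and> (\<forall>c x. T (c *\<^sub>C x) = c *\<^sub>C T x)"

definition positive_op :: "('a::complex_inner \<Rightarrow> 'a) \<Rightarrow> bool" where
  "positive_op A \<longleftrightarrow> bounded_clinear A \<and> (\<forall>x. cinner (A x) x \<in> \<real>\<^sub>\<ge>\<^sub>0)"

definition cadjoint :: "('a::chilbert_space \<Rightarrow> 'a) \<Rightarrow> 'a \<Rightarrow> 'a" where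
  "cadjoint T = (THE S. bounded_clinear S \<and> (\<forall>x y. cinner (T x) y = cinner x (S y)))"

definition A_inner :: "('a::chilbert_space \<Rightarrow> 'a) \<Rightarrow> 'a \<Rightarrow> 'a \<Rightarrow> complex" where
  "A_inner A x y = cinner (A x) y"

definition A_seminorm :: "('a::chilbert_space \<Rightarrow> 'a) \<Rightarrow> 'a \<Rightarrow> real" where
  "A_seminorm A x = sqrt (Re (A_inner A x x))"

definition A_ops :: "('a::chilbert_space \<Rightarrow> 'a) \<Rightarrow> ('a \<Rightarrow> 'a) set" where
  "A_ops A = {T. bounded_clinear T \<and> range (cadjoint T \<circ> A) \<subseteq> range A}"

definition A_adjoint :: "('a::chilbert_space \<Rightarrow> 'a) \<Rightarrow> ('a \<Rightarrow> 'a) \<Rightarrow> 'a \<Rightarrow> 'a" where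
  "A_adjoint A T =
     (THE X. bounded_clinear X \<and> A \<circ> X = cadjoint T \<circ> A \<and> range X \<subseteq> closure (range A))"

text \<open>
  The suprema are of sets of nonnegative reals. Inserting 0 changes nothing unless \<open>A = 0\<close>, when
  no vector has seminorm 1 and the supremum of the empty set is taken in \<open>[0,\<infinity>)\<close>, that is, 0
  (the supremum of the empty set of reals is unspecified in HOL).
\<close>

definition A_norm :: "('a::chilbert_space \<Rightarrow> 'a) \<Rightarrow> ('a \<Rightarrow> 'a) \<Rightarrow> real" where
  "A_norm A T =
     Sup (insert 0 {A_seminorm A (T x) |x. x \<in> closure (range A) \<and> A_seminorm A x = 1})"

definition A_num_radius :: "('a::chilbert_space \<Rightarrow> 'a) \<Rightarrow> ('a \<Rightarrow> 'a) \<Rightarrow> real" where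
  "A_num_radius A T = Sup (insert 0 {cmod (A_inner A (T x) x) |x. A_seminorm A x = 1})"

definition A_Re :: "('a::chilbert_space \<Rightarrow> 'a) \<Rightarrow> ('a \<Rightarrow> 'a) \<Rightarrow> 'a \<Rightarrow> 'a" where
  "A_Re A T = (\<lambda>x. (1 / 2) *\<^sub>C (T x + A_adjoint A T x))"

definition A_Im :: "('a::chilbert_space \<Rightarrow> 'a) \<Rightarrow> ('a \<Rightarrow> 'a) \<Rightarrow> 'a \<Rightarrow> 'a" where
  "A_Im A T = (\<lambda>x. (1 / (2 * \<i>)) *\<^sub>C (T x - A_adjoint A T x))"

end

(*
  Every T in B_A(H) is bounded for the seminorm of the semi-inner product <x,y>_A = <Ax,y>, so one
  can compute with this form alone. If T' is the A-adjoint of T, then for ||x||_A = 1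

    |<(TX +- YT)x,x>_A| <= |<Xx,T'x>_A| + |<Tx,Y'x>_A| <= max(||X||_A,||Y||_A) (||T'x||_A + ||Tx||_A),

  and with T = P + iQ, T' = P - iQ the parallelogram law gives

    ||Tx||_A^2 + ||T'x||_A^2 = 2 (||Px||_A^2 + ||Qx||_A^2) = ||(P+Q)x||_A^2 + ||(P-Q)x||_A^2.

  The operators P, Q, P+Q, P-Q are symmetric for the form, so their A-norms are the suprema of
  their quadratic forms, which are at most w_A(T) for P and Q and sqrt 2 w_A(T) for P+Q and P-Q.
  Both bounds now follow from a + b + |a - b| = 2 max(a, b).
*)

theory Submission
  imports Defs
begin

section \<open>Hilbert space preliminaries\<close>

text \<open>The form may be degenerate and the range of \<open>A\<close> need not be closed, so
  neither the norm boundedness of an A-adjoint nor the boundedness of an operator for the seminorm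
  is a matter of algebra. The first rests on uniform boundedness, the second on comparing the growth
  of the powers of a symmetric operator in the seminorm and in the norm. Both must precede the
  estimates: \<open>cadjoint\<close> and \<open>A_adjoint\<close> are definite descriptions, and a
  real supremum says nothing about a set until that set is known to be bounded above. The two
  radicands share one argument: any \<open>R \<ge> 0\<close> such that 4R bounds the sum of squares
  of the seminorms of Tx and T'x on unit vectors yields the estimate with \<open>sqrt R\<close>. The
  factor 2 sqrt 2 arises from a + b \<le> sqrt (2 (a^2 + b^2)) \<le> sqrt (8R).\<close>

lemma subspace_closure:
  fixes S :: "'a::real_normed_vector set"
  assumes S: "subspace S"
  shows "subspace (closure S)"
proof (rule subspaceI)
  show "0 \<in> closure S"
    using subspace_0[OF S] closure_subset by blast
  show "x + y \<in> closure S" if xy: "x \<in> closure S" "y \<in> closure S" for x y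
  proof -
    obtain f g where "\<forall>n. f n \<in> S" "f \<longlonglongrightarrow> x" "\<forall>n. g n \<in> S" "g \<longlonglongrightarrow> y"
      using xy unfolding closure_sequential by blast
    then show ?thesis
      unfolding closure_sequential
      by (intro exI[of _ "\<lambda>n. f n + g n"]) (auto intro: tendsto_add subspace_add[OF S])
  qed
  show "c *\<^sub>R x \<in> closure S" if x: "x \<in> closure S" for c x
  proof -
    obtain f where "\<forall>n. f n \<in> S" "f \<longlonglongrightarrow> x"
      using x unfolding closure_sequential by blast
    then show ?thesis
      unfolding closure_sequential
      by (intro exI[of _ "\<lambda>n. c *\<^sub>R f n"]) (auto intro: tendsto_scaleR subspace_scale[OF S])
  qed
qed

text \<open>A minimizing sequence for the distance from \<open>x\<close> to \<open>M\<close> is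
  Cauchy by the parallelogram law. Its limit attains the distance, and a minimizer cannot be
  improved in any direction \<open>v\<close> of \<open>M\<close>.\<close>

theorem orthogonal_projection_exists:
  fixes M :: "'a::{real_inner, complete_space} set"
  assumes M: "subspace M" "closed M"
  shows "\<exists>u\<in>M. \<forall>v\<in>M. inner (x - u) v = 0"
proof -
  define d where "d = (INF v\<in>M. (norm (x - v))\<^sup>2)"
  have ne: "M \<noteq> {}"
    using subspace_0[OF M(1)] by blast
  have bdd: "bdd_below ((\<lambda>v. (norm (x - v))\<^sup>2) ` M)"
    by (rule bdd_belowI[of _ 0]) auto
  have d_le: "d \<le> (norm (x - v))\<^sup>2" if "v \<in> M" for v
    unfolding d_def using bdd that by (rule cINF_lower)
  have "\<exists>v\<in>M. (norm (x - v))\<^sup>2 < d + inverse (real (Suc n))" for n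
  proof -
    have "d < d + inverse (real (Suc n))" by simp
    then show ?thesis
      using cINF_less_iff[OF ne bdd] unfolding d_def by blast
  qed
  then obtain f where f: "\<And>n. f n \<in> M"
    and fd: "\<And>n. (norm (x - f n))\<^sup>2 < d + inverse (real (Suc n))"
    by metis
  have close: "(norm (f m - f n))\<^sup>2 \<le> 2 * inverse (real (Suc m)) + 2 * inverse (real (Suc n))" for m n
  proof -
    \<comment> \<open>The midpoint stays in \<open>M\<close>, so its squared distance to
      \<open>x\<close> is at least \<open>d\<close>; this bounds the negative term of the
      parallelogram law.\<close>
    have "(1/2) *\<^sub>R (f m + f n) \<in> M"
      using f M(1) by (simp add: subspace_add subspace_scale)
    then have "d \<le> (norm (x - (1/2) *\<^sub>R (f m + f n)))\<^sup>2"
      by (rule d_le)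
    moreover have "(norm (f m - f n))\<^sup>2 =
        2 * (norm (x - f m))\<^sup>2 + 2 * (norm (x - f n))\<^sup>2 - 4 * (norm (x - (1/2) *\<^sub>R (f m + f n)))\<^sup>2"
      by (simp add: power2_norm_eq_inner inner_diff inner_add inner_commute algebra_simps)
    ultimately show ?thesis
      using fd[of m] fd[of n] by linarith
  qed
  have "Cauchy f"
  proof (rule metric_CauchyI)
    fix e :: real assume e: "0 < e"
    obtain N where N: "inverse (real (Suc N)) < e\<^sup>2 / 4"
      using reals_Archimedean[of "e\<^sup>2 / 4"] e by auto
    have "dist (f m) (f n) < e" if "N \<le> m" "N \<le> n" for m n
    proof -
      have "inverse (real (Suc m)) \<le> inverse (real (Suc N))"
        "inverse (real (Suc n)) \<le> inverse (real (Suc N))"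
        using that by (auto intro!: le_imp_inverse_le)
      then have "(norm (f m - f n))\<^sup>2 < e\<^sup>2"
        using close[of m n] N by linarith
      then show ?thesis
        using e by (simp add: dist_norm power2_less_imp_less)
    qed
    then show "\<exists>N. \<forall>m\<ge>N. \<forall>n\<ge>N. dist (f m) (f n) < e" by blast
  qed
  then obtain u where u: "f \<longlonglongrightarrow> u"
    using Cauchy_convergent convergent_def by blast
  have uM: "u \<in> M"
    using closed_sequentially[OF M(2)] f u by blast
  have "(\<lambda>n. (norm (x - f n))\<^sup>2) \<longlonglongrightarrow> (norm (x - u))\<^sup>2"
    by (intro tendsto_intros u)
  moreover have "(\<lambda>n. d + inverse (real (Suc n))) \<longlonglongrightarrow> d + 0"
    by (intro tendsto_intros LIMSEQ_inverse_real_of_nat)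
  ultimately have u_le: "(norm (x - u))\<^sup>2 \<le> d"
    using fd by (intro LIMSEQ_le[of _ "(norm (x - u))\<^sup>2" _ d]) (auto intro: less_imp_le)
  have "inner (x - u) v = 0" if v: "v \<in> M" for v
  proof (rule ccontr)
    assume neq: "inner (x - u) v \<noteq> 0"
    then have v0: "v \<noteq> 0" by auto
    \<comment> \<open>The minimizer of the quadratic t -> |x - u - t v|^2.\<close>
    define t where "t = inner (x - u) v / (norm v)\<^sup>2"
    have "u + t *\<^sub>R v \<in> M"
      using uM v M(1) by (simp add: subspace_add subspace_scale)
    then have "(norm (x - u))\<^sup>2 \<le> (norm (x - (u + t *\<^sub>R v)))\<^sup>2"
      by (intro order_trans[OF u_le] d_le)
    also have "\<dots> = (norm (x - u))\<^sup>2 - 2 * t * inner (x - u) v + t\<^sup>2 * (norm v)\<^sup>2"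
      unfolding power2_norm_eq_inner
      by (simp add: inner_diff inner_add inner_commute algebra_simps power2_eq_square)
    also have "\<dots> = (norm (x - u))\<^sup>2 - (inner (x - u) v)\<^sup>2 / (norm v)\<^sup>2"
      using v0 by (simp add: t_def field_simps power2_eq_square)
    finally have "(inner (x - u) v)\<^sup>2 / (norm v)\<^sup>2 \<le> 0" by simp
    moreover have "(inner (x - u) v)\<^sup>2 / (norm v)\<^sup>2 > 0"
      using neq v0 by simp
    ultimately show False by linarith
  qed
  with uM show ?thesis by blast
qed

text \<open>The kernel of a nonzero \<open>f\<close> is a closed hyperplane. A vector
  \<open>z\<close> orthogonal to it determines \<open>f\<close> up to a scalar, fixed by the value
  \<open>f z\<close>.\<close>

theorem riesz_representation:
  fixes f :: "'a::{real_inner, complete_space} \<Rightarrow> real"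
  assumes f: "bounded_linear f"
  shows "\<exists>y. \<forall>x. f x = inner x y"
proof (cases "\<forall>x. f x = 0")
  case True
  then show ?thesis by (intro exI[of _ 0]) simp
next
  case False
  interpret bounded_linear f by fact
  obtain x0 where x0: "f x0 \<noteq> 0" using False by blast
  define M where "M = {x. f x = 0}"
  have "subspace M" by (auto simp: M_def subspace_def add scale)
  moreover have "closed M"
    unfolding M_def by (intro closed_Collect_eq continuous_intros linear_continuous_on f)
  ultimately obtain u where u: "u \<in> M" and orth: "\<And>v. v \<in> M \<Longrightarrow> inner (x0 - u) v = 0"
    using orthogonal_projection_exists[of M x0] by blast
  define z where "z = x0 - u"
  have fz: "f z \<noteq> 0"
    using x0 u by (simp add: z_def M_def diff)
  then have z0: "z \<noteq> 0" by auto
  have "f x = inner x ((f z / inner z z) *\<^sub>R z)" for x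
  proof -
    have "x - (f x / f z) *\<^sub>R z \<in> M"
      using fz by (simp add: M_def diff scale)
    then have "inner z (x - (f x / f z) *\<^sub>R z) = 0"
      using orth by (simp add: z_def)
    then show ?thesis
      using fz z0 by (simp add: inner_diff_right inner_commute field_simps)
  qed
  then show ?thesis by blast
qed

text \<open>The closed sets \<open>E n\<close> of points where the whole family is bounded by n
  cover the space, so by Baire one of them contains a ball; linearity carries the bound on that ball
  to all vectors.\<close>

theorem uniform_boundedness:
  fixes F :: "('a::{real_normed_vector, complete_space} \<Rightarrow> 'b::real_normed_vector) set"
  assumes lin: "\<And>f. f \<in> F \<Longrightarrow> bounded_linear f"
    and pointwise: "\<And>x. \<exists>c. \<forall>f\<in>F. norm (f x) \<le> c"
  shows "\<exists>c. \<forall>f\<in>F. \<forall>x. norm (f x) \<le> c * norm x"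
proof -
  define E where "E n = {x. \<forall>f\<in>F. norm (f x) \<le> real n}" for n
  have closedE: "closed (E n)" for n
  proof -
    have "E n = (\<Inter>f\<in>F. {x. norm (f x) \<le> real n})" by (auto simp: E_def)
    moreover have "closed {x. norm (f x) \<le> real n}" if "f \<in> F" for f
      using linear_continuous_on[OF lin[OF that], of UNIV]
      by (intro closed_Collect_le continuous_on_norm continuous_on_const) auto
    ultimately show ?thesis by auto
  qed
  have cover: "(\<Union>n. E n) = UNIV"
  proof -
    have "\<exists>n. x \<in> E n" for x
    proof -
      obtain c where "\<forall>f\<in>F. norm (f x) \<le> c" using pointwise by blast
      moreover obtain n where "c \<le> real n" using real_arch_simple by blast
      ultimately show ?thesis unfolding E_def by (blast intro: order_trans)
    qed
    then show ?thesis by blast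
  qed
  obtain n where "interior (E n) \<noteq> {}"
  proof (rule ccontr)
    assume "\<not> thesis"
    with that have "\<And>n. interior (E n) = {}" by blast
    then have "Met_TC.mtopology interior_of \<Union>(range E) = {}"
      by (intro Met_TC.metric_Baire_category_alt) (auto simp: closedE complete_UNIV)
    then show False using cover by simp
  qed
  then obtain a r where r: "r > 0" and ball: "cball a r \<subseteq> E n"
    by (metis equals0I mem_interior_cball)
  have "norm (f x) \<le> (2 * real n / r) * norm x" if f: "f \<in> F" for f x
  proof (cases "x = 0")
    case True
    then show ?thesis using bounded_linear.linear[OF lin[OF f]] by (simp add: linear_0)
  next
    case False
    interpret bounded_linear f using lin[OF f] .
    \<comment> \<open>Rescaled so that \<open>a + y\<close> is still in the ball; \<open>f y\<close>
      is then a difference of two values of norm at most n, whence the constant 2n/r.\<close>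
    define y where "y = (r / norm x) *\<^sub>R x"
    have "norm y = r" using False r by (simp add: y_def)
    then have "a \<in> E n" "a + y \<in> E n" using ball r by (auto simp: dist_norm)
    then have "norm (f a) \<le> real n" "norm (f (a + y)) \<le> real n"
      using f by (auto simp: E_def)
    moreover have "f y = f (a + y) - f a" by (simp add: add)
    ultimately have "norm (f y) \<le> 2 * real n"
      using norm_triangle_ineq4[of "f (a + y)" "f a"] by simp
    moreover have "norm (f y) = (r / norm x) * norm (f x)"
      using r by (simp add: y_def scale)
    ultimately show ?thesis
      using r False by (simp add: field_simps)
  qed
  then show ?thesis by blast
qed

section \<open>Adjoints\<close>

lemma cinner_add_right: "cinner x (y + z) = cinner x y + cinner x z"
  by (metis cinner_add_left cinner_commute complex_cnj_add)

lemma cinner_scaleC_right: "cinner x (c *\<^sub>C y) = cnj c * cinner x y"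
  by (metis cinner_scaleC_left cinner_commute complex_cnj_mult)

lemma scaleC_one: "1 *\<^sub>C x = (x::'a::complex_inner)"
  using scaleC_of_real[of 1 x] by simp

lemma scaleC_minus_one: "(-1) *\<^sub>C x = - (x::'a::complex_inner)"
  using scaleC_of_real[of "-1" x] by simp

lemma cinner_zero_left [simp]: "cinner 0 x = 0"
  using cinner_add_left[of 0 0 x] by simp

lemma cinner_zero_right [simp]: "cinner x 0 = 0"
  using cinner_add_right[of x 0 0] by simp

lemma cinner_minus_left: "cinner (- x) y = - cinner x y"
  using cinner_add_left[of x "- x" y] by (simp add: add_eq_0_iff)

lemma cinner_minus_right: "cinner x (- y) = - cinner x y"
  using cinner_add_right[of x y "- y"] by (simp add: add_eq_0_iff)

lemma cinner_diff_left: "cinner (x - y) z = cinner x z - cinner y z"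
  using cinner_add_left[of x "- y" z] by (simp add: cinner_minus_left)

lemma cinner_diff_right: "cinner x (y - z) = cinner x y - cinner x z"
  using cinner_add_right[of x y "- z"] by (simp add: cinner_minus_right)

lemma cinner_ext:
  assumes "\<And>x. cinner x a = cinner x b"
  shows "a = b"
proof -
  have "cinner (a - b) (a - b) = 0"
    using assms by (simp add: cinner_diff_right)
  then have "inner (a - b) (a - b) = 0"
    by (simp add: inner_eq_Re_cinner)
  then show ?thesis by simp
qed

text \<open>Projection and Riesz representation are stated for the real inner product. Complex
  linearity recovers the imaginary part, since Im c = Re (-i c).\<close>

lemma cinner_eqI_inner:
  assumes inner: "\<And>x. inner (T x) y = inner x z" and T: "\<And>c x. T (c *\<^sub>C x) = c *\<^sub>C T x"
  shows "cinner (T x) y = cinner x z"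
proof (rule complex_eqI)
  show "Re (cinner (T x) y) = Re (cinner x z)"
    using inner[of x] by (simp add: inner_eq_Re_cinner)
  show "Im (cinner (T x) y) = Im (cinner x z)"
    using inner[of "(-\<i>) *\<^sub>C x"] by (simp add: inner_eq_Re_cinner T cinner_scaleC_left)
qed

lemma bounded_clinearD:
  assumes "bounded_clinear T"
  shows "bounded_linear T" "T (c *\<^sub>C x) = c *\<^sub>C T x"
    "T (x + y) = T x + T y" "T (x - y) = T x - T y" "T 0 = 0"
  using assms linear_add linear_diff linear_0 bounded_linear.linear
  unfolding bounded_clinear_def by blast+

lemma bounded_clinearI:
  assumes "\<And>x y. T (x + y) = T x + T y" and scaleC: "\<And>c x. T (c *\<^sub>C x) = c *\<^sub>C T x"
    and "\<And>x. norm (T x) \<le> K * norm x"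
  shows "bounded_clinear T"
proof -
  have "T (r *\<^sub>R x) = r *\<^sub>R T x" for r x
    using scaleC[of "complex_of_real r"] by (simp add: scaleC_of_real)
  then have "bounded_linear T"
    using assms(1,3) by (intro bounded_linear_intro[of _ K]) (auto simp: mult.commute)
  then show ?thesis using scaleC by (simp add: bounded_clinear_def)
qed

lemma norm_scaleC: "norm (c *\<^sub>C x) = cmod c * norm (x::'a::complex_inner)"
proof -
  have "Im (cinner x x) = 0"
    using arg_cong[OF cinner_commute[of x x], of Im] by simp
  then have "inner (c *\<^sub>C x) (c *\<^sub>C x) = ((Re c)\<^sup>2 + (Im c)\<^sup>2) * inner x x"
    by (simp add: inner_eq_Re_cinner cinner_scaleC_left cinner_scaleC_right
        power2_eq_square algebra_simps)
  also have "\<dots> = (cmod c)\<^sup>2 * inner x x" by (simp only: cmod_power2)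
  finally have "inner (c *\<^sub>C x) (c *\<^sub>C x) = (cmod c)\<^sup>2 * inner x x" .
  then show ?thesis
    by (simp add: norm_eq_sqrt_inner real_sqrt_mult)
qed

lemma bounded_linear_scaleC: "bounded_linear ((*\<^sub>C) c :: 'a::complex_inner \<Rightarrow> 'a)"
proof (rule bounded_linear_intro[of _ "cmod c"])
  show "c *\<^sub>C r *\<^sub>R x = r *\<^sub>R c *\<^sub>C x" for r and x :: 'a
    by (simp add: scaleC_of_real[symmetric] scaleC_scaleC mult.commute)
qed (simp_all add: scaleC_add_right norm_scaleC mult.commute)

text \<open>Riesz representation of \<open>x \<mapsto> inner (T x) y\<close> provides the value at
  \<open>y\<close>; linearity and uniqueness follow because the inner product separates
  points.\<close>

lemma adjoint_exists:
  fixes T :: "'a::chilbert_space \<Rightarrow> 'a"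
  assumes T: "bounded_clinear T"
  shows "\<exists>!S. bounded_clinear S \<and> (\<forall>x y. cinner (T x) y = cinner x (S y))"
proof -
  note bl = bounded_clinearD(1)[OF T]
  have "\<exists>z. \<forall>x. inner (T x) y = inner x z" for y
    by (intro riesz_representation bounded_linear_inner_left_comp bl)
  then obtain S where S: "\<And>x y. inner (T x) y = inner x (S y)" by metis
  have cS: "cinner (T x) y = cinner x (S y)" for x y
    by (rule cinner_eqI_inner[OF S bounded_clinearD(2)[OF T]])
  have "bounded_clinear S"
  proof (rule bounded_clinearI[of _ "onorm T"])
    show "S (x + y) = S x + S y" for x y
      by (rule cinner_ext) (simp add: cS[symmetric] cinner_add_right)
    show "S (c *\<^sub>C x) = c *\<^sub>C S x" for c x
      by (rule cinner_ext) (simp add: cS[symmetric] cinner_scaleC_right)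
    show "norm (S y) \<le> onorm T * norm y" for y
    proof (cases "S y = 0")
      case True
      then show ?thesis using onorm_pos_le[OF bl] by simp
    next
      case False
      have "norm (S y) * norm (S y) = inner (T (S y)) y"
        by (simp add: S power2_norm_eq_inner[symmetric] power2_eq_square)
      also have "\<dots> \<le> norm (T (S y)) * norm y" by (rule norm_cauchy_schwarz)
      also have "\<dots> \<le> (onorm T * norm (S y)) * norm y"
        by (intro mult_right_mono onorm bl) simp
      finally show ?thesis using False by (simp add: mult.commute mult.left_commute)
    qed
  qed
  moreover have "S' = S" if "\<forall>x y. cinner (T x) y = cinner x (S' y)" for S'
    using that cS by (intro ext cinner_ext) metis
  ultimately show ?thesis using cS by blast
qed

lemma cinner_cadjoint:
  assumes "bounded_clinear T"
  shows "cinner (T x) y = cinner x (cadjoint T y)"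
  using theI'[OF adjoint_exists[OF assms]] unfolding cadjoint_def by blast

lemma bounded_clinear_cadjoint:
  assumes "bounded_clinear T"
  shows "bounded_clinear (cadjoint T)"
  using theI'[OF adjoint_exists[OF assms]] unfolding cadjoint_def by blast

section \<open>The form of a positive operator: symmetry, kernel, range and adjoint\<close>

locale positive_operator =
  fixes A :: "'a::chilbert_space \<Rightarrow> 'a"
  assumes positive: "positive_op A"
begin

lemma bounded_clinear_A: "bounded_clinear A"
  using positive by (simp add: positive_op_def)

lemmas A_simps = bounded_clinearD(2-5)[OF bounded_clinear_A]

lemma positive_form: "Re (A_inner A x x) \<ge> 0" "Im (A_inner A x x) = 0"
  using positive by (auto simp: positive_op_def A_inner_def complex_nonneg_Reals_iff)

lemma A_inner_simps:
  "A_inner A (x + y) z = A_inner A x z + A_inner A y z"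
  "A_inner A (x - y) z = A_inner A x z - A_inner A y z"
  "A_inner A z (x + y) = A_inner A z x + A_inner A z y"
  "A_inner A z (x - y) = A_inner A z x - A_inner A z y"
  "A_inner A (c *\<^sub>C x) z = c * A_inner A x z"
  "A_inner A z (c *\<^sub>C x) = cnj c * A_inner A z x"
  by (simp_all add: A_inner_def A_simps cinner_add_left cinner_diff_left cinner_add_right
      cinner_diff_right cinner_scaleC_left cinner_scaleC_right)

text \<open>Polarization: the form is real on the diagonal, and expanding it at \<open>x + y\<close>
  and at \<open>x + \<i> *\<^sub>C y\<close> gives the imaginary and the real part of the
  identity.\<close>

lemma A_inner_commute: "A_inner A x y = cnj (A_inner A y x)"
proof (rule complex_eqI)
  show "Im (A_inner A x y) = Im (cnj (A_inner A y x))"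
    using positive_form(2)[of "x + y"] positive_form(2)[of x] positive_form(2)[of y]
    by (simp add: A_inner_simps)
  show "Re (A_inner A x y) = Re (cnj (A_inner A y x))"
    using positive_form(2)[of "x + \<i> *\<^sub>C y"] positive_form(2)[of x] positive_form(2)[of y]
    by (simp add: A_inner_simps)
qed

lemma A_self_adjoint: "cinner (A x) y = cinner x (A y)"
  using A_inner_commute[of x y] by (simp add: A_inner_def cinner_commute[of x "A y"])

lemma subspace_closure_range: "subspace (closure (range A))"
  by (intro subspace_closure linear_subspace_image subspace_UNIV bounded_linear.linear
      bounded_clinearD(1)[OF bounded_clinear_A])

text \<open>The residual w = x - u of the projection is orthogonal to A(Aw), and self-adjointness
  turns this into |Aw|^2 = 0.\<close>

lemma kernel_range_decomposition:
  obtains u z where "x = u + z" "u \<in> closure (range A)" "A z = 0"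
proof -
  obtain u where u: "u \<in> closure (range A)"
    and orth: "\<And>v. v \<in> closure (range A) \<Longrightarrow> inner (x - u) v = 0"
    using orthogonal_projection_exists[OF subspace_closure_range, of x] by auto
  have "inner (x - u) (A (A (x - u))) = 0"
    using orth closure_subset[of "range A"] by blast
  then have "inner (A (x - u)) (A (x - u)) = 0"
    by (simp add: inner_eq_Re_cinner A_self_adjoint)
  then have "A (x - u) = 0" by simp
  with u show thesis using that[of u "x - u"] by simp
qed

text \<open>If Au = Av, then u - v is orthogonal to the range of \<open>A\<close> by
  self-adjointness, hence to its closure, which contains u - v. This makes the A-adjoint unique and
  additive.\<close>

lemma A_inj_on_closure_range: "inj_on A (closure (range A))"
proof (rule inj_onI)
  fix u v assume u: "u \<in> closure (range A)" and v: "v \<in> closure (range A)" and eq: "A u = A v"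
  have w: "u - v \<in> closure (range A)"
    using subspace_closure_range u v by (rule subspace_diff)
  have "closed {x. inner (u - v) x = 0}"
    by (intro closed_Collect_eq continuous_intros)
  moreover have "range A \<subseteq> {x. inner (u - v) x = 0}"
    using eq by (auto simp: inner_eq_Re_cinner A_self_adjoint[symmetric] A_simps)
  ultimately have "inner (u - v) (u - v) = 0"
    using w closure_minimal by blast
  then show "u = v" by simp
qed

text \<open>Boundedness comes from the uniform boundedness principle, applied to the functionals
  \<open>\<langle>\<cdot>, A T v\<rangle> = \<langle>X \<cdot>, A v\<rangle>\<close> with \<open>\<parallel>A v\<parallel> \<le> 1\<close>.\<close>

lemma bounded_A_adjoint:
  assumes T: "bounded_clinear T"
    and X: "\<And>x. A (X x) = cadjoint T (A x)" "\<And>x. X x \<in> closure (range A)"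
  shows "\<exists>K. \<forall>x. norm (X x) \<le> K * norm x"
proof -
  have eq: "inner x (A (T v)) = inner (X x) (A v)" for x v
  proof -
    have "cinner x (A (T v)) = cinner (A x) (T v)" by (simp add: A_self_adjoint)
    also have "\<dots> = cnj (cinner v (cadjoint T (A x)))"
      by (subst cinner_commute) (simp add: cinner_cadjoint[OF T])
    also have "\<dots> = cinner (A (X x)) v" by (simp add: X(1) cinner_commute[symmetric])
    finally show ?thesis by (simp add: inner_eq_Re_cinner A_self_adjoint)
  qed
  define F where "F = (\<lambda>v x. inner x (A (T v))) ` {v. norm (A v) \<le> 1}"
  have "\<exists>c. \<forall>f\<in>F. \<forall>x. norm (f x) \<le> c * norm x"
  proof (rule uniform_boundedness)
    show "bounded_linear f" if "f \<in> F" for f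
      using that bounded_linear_inner_left by (auto simp: F_def)
    have "\<bar>inner (X x) (A v)\<bar> \<le> norm (X x)" if "norm (A v) \<le> 1" for x v
      using Cauchy_Schwarz_ineq2[of "X x" "A v"] mult_left_mono[OF that, of "norm (X x)"] by simp
    then show "\<exists>c. \<forall>f\<in>F. norm (f x) \<le> c" for x
      unfolding F_def eq by auto
  qed
  then obtain c where c: "\<And>x v. norm (A v) \<le> 1 \<Longrightarrow> \<bar>inner (X x) (A v)\<bar> \<le> c * norm x"
    unfolding F_def eq by auto
  have scaled: "\<bar>inner (X x) (A v)\<bar> \<le> c * norm x * norm (A v)" for x v
  proof (cases "A v = 0")
    case False
    have "A ((1 / norm (A v)) *\<^sub>R v) = (1 / norm (A v)) *\<^sub>R A v"
      using bounded_clinearD(1)[OF bounded_clinear_A] by (simp add: bounded_linear.linear linear_cmul)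
    then show ?thesis
      using c[of "(1 / norm (A v)) *\<^sub>R v" x] False by (simp add: field_simps)
  qed simp
  have "norm (X x) \<le> c * norm x" for x
  proof (cases "X x = 0")
    case True
    have "0 \<le> c * norm x" using c[of 0 x] by (simp add: A_simps)
    then show ?thesis using True by simp
  next
    case False
    \<comment> \<open>The estimate is a closed condition on w, so it passes from the range of
      \<open>A\<close> to its closure, where w = \<open>X x\<close> is admissible.\<close>
    have "closed {w. \<bar>inner (X x) w\<bar> \<le> c * norm x * norm w}"
      by (intro closed_Collect_le continuous_intros)
    moreover have "range A \<subseteq> {w. \<bar>inner (X x) w\<bar> \<le> c * norm x * norm w}"
      using scaled by auto
    ultimately have "\<bar>inner (X x) (X x)\<bar> \<le> c * norm x * norm (X x)"
      using X(2)[of x] closure_minimal by blast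
    then have "norm (X x) * norm (X x) \<le> (c * norm x) * norm (X x)"
      by (simp add: power2_norm_eq_inner[symmetric] power2_eq_square)
    then show ?thesis using False by simp
  qed
  then show ?thesis by blast
qed

text \<open>A preimage under \<open>A\<close> of T*Ax is chosen pointwise and replaced by its
  component in the closure of the range. Injectivity of \<open>A\<close> there forces the choice to
  be linear and unique.\<close>

lemma A_adjoint_exists:
  assumes T: "T \<in> A_ops A"
  shows "\<exists>!X. bounded_clinear X \<and> A \<circ> X = cadjoint T \<circ> A \<and> range X \<subseteq> closure (range A)"
proof -
  have bT: "bounded_clinear T" and ran: "range (cadjoint T \<circ> A) \<subseteq> range A"
    using T by (auto simp: A_ops_def)
  note sub = subspace_closure_range
  have "\<exists>y. A y = cadjoint T (A x) \<and> y \<in> closure (range A)" for x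
  proof -
    obtain y where "A y = cadjoint T (A x)" using ran by (metis comp_apply rangeI rangeE subsetD)
    moreover obtain u z where "y = u + z" "u \<in> closure (range A)" "A z = 0"
      by (rule kernel_range_decomposition)
    ultimately show ?thesis by (auto simp: A_simps)
  qed
  then obtain X where X: "\<And>x. A (X x) = cadjoint T (A x)" "\<And>x. X x \<in> closure (range A)"
    by metis
  obtain K where K: "\<And>x. norm (X x) \<le> K * norm x"
    using bounded_A_adjoint[OF bT X] by blast
  note adj = bounded_clinearD[OF bounded_clinear_cadjoint[OF bT]]
  \<comment> \<open>So far the closure is only a real subspace; complex multiples need an argument
    of their own.\<close>
  have scaleC: "c *\<^sub>C y \<in> closure (range A)" if "y \<in> closure (range A)" for c y
  proof -
    have "(*\<^sub>C) c ` closure (range A) \<subseteq> closure ((*\<^sub>C) c ` range A)"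
      by (rule closure_bounded_linear_image_subset[OF bounded_linear_scaleC])
    also have "(*\<^sub>C) c ` range A \<subseteq> range A"
      by (auto simp: A_simps(1)[symmetric])
    finally show ?thesis using that closure_mono by blast
  qed
  have "bounded_clinear X"
  proof (rule bounded_clinearI[OF _ _ K])
    show "X (x + y) = X x + X y" for x y
      by (rule inj_onD[OF A_inj_on_closure_range])
        (simp_all add: X A_simps adj subspace_add[OF sub])
    show "X (c *\<^sub>C x) = c *\<^sub>C X x" for c x
      by (rule inj_onD[OF A_inj_on_closure_range])
        (simp_all add: X A_simps adj scaleC)
  qed
  moreover have "A \<circ> X = cadjoint T \<circ> A" "range X \<subseteq> closure (range A)"
    using X by (simp_all add: comp_def image_subset_iff)
  ultimately show ?thesis
  proof (intro ex1I[of _ X] conjI; (elim conjE)?)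
    fix X' assume eq: "A \<circ> X' = cadjoint T \<circ> A" and ran': "range X' \<subseteq> closure (range A)"
    show "X' = X"
    proof
      fix x
      have "A (X' x) = A (X x)"
        unfolding X(1) using eq by (metis comp_apply)
      moreover have "X' x \<in> closure (range A)" using ran' by blast
      ultimately show "X' x = X x"
        using X(2) by (rule inj_onD[OF A_inj_on_closure_range])
    qed
  qed
qed

lemma A_adjoint_spec:
  assumes T: "T \<in> A_ops A"
  shows "bounded_clinear (A_adjoint A T)" "A (A_adjoint A T x) = cadjoint T (A x)"
proof -
  note * = theI'[OF A_adjoint_exists[OF T], folded A_adjoint_def]
  show "bounded_clinear (A_adjoint A T)" using * by blast
  show "A (A_adjoint A T x) = cadjoint T (A x)" using * by (metis comp_apply)
qed

section \<open>The seminorm and the numerical radius\<close>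

lemma A_seminorm_nonneg [simp]: "0 \<le> A_seminorm A x"
  by (simp add: A_seminorm_def positive_form)

lemma A_inner_self: "A_inner A x x = complex_of_real ((A_seminorm A x)\<^sup>2)"
  by (rule complex_eqI) (simp_all add: A_seminorm_def positive_form)

lemma A_seminorm_power2: "(A_seminorm A x)\<^sup>2 = Re (A_inner A x x)"
  by (simp add: A_seminorm_def positive_form)

lemma A_seminorm_scaleC: "A_seminorm A (c *\<^sub>C x) = cmod c * A_seminorm A x"
proof -
  have "A_inner A (c *\<^sub>C x) (c *\<^sub>C x) = (c * cnj c) * A_inner A x x"
    by (simp add: A_inner_simps)
  also have "\<dots> = complex_of_real ((cmod c)\<^sup>2 * (A_seminorm A x)\<^sup>2)"
    by (simp add: A_inner_self complex_norm_square del: of_real_power)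
  finally show ?thesis
    by (simp add: A_seminorm_def[of A "c *\<^sub>C x"] real_sqrt_mult)
qed

lemma A_seminorm_scaleR: "A_seminorm A (r *\<^sub>R x) = \<bar>r\<bar> * A_seminorm A x"
  using A_seminorm_scaleC[of "complex_of_real r" x] by (simp add: scaleC_of_real)

text \<open>Cauchy-Schwarz from the nonnegativity of a binary quadratic form. Its coefficient
  \<open>b\<close> can vanish for a nonzero \<open>y\<close>, hence the separate case.\<close>

lemma A_inner_Re_bound: "Re (A_inner A x y) \<le> A_seminorm A x * A_seminorm A y"
proof -
  define a b c where "a = (A_seminorm A x)\<^sup>2" and "b = (A_seminorm A y)\<^sup>2" and "c = Re (A_inner A x y)"
  have quad: "0 \<le> a * s\<^sup>2 - 2 * c * s * t + b * t\<^sup>2" for s t :: real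
  proof -
    have "Re (A_inner A y x) = c"
      using A_inner_commute[of y x] by (simp add: c_def)
    moreover have "0 \<le> Re (A_inner A (complex_of_real s *\<^sub>C x - complex_of_real t *\<^sub>C y)
        (complex_of_real s *\<^sub>C x - complex_of_real t *\<^sub>C y))"
      by (rule positive_form)
    ultimately show ?thesis
      unfolding a_def b_def c_def A_seminorm_power2
      by (simp add: A_inner_simps power2_eq_square algebra_simps)
  qed
  have nn: "0 \<le> a" "0 \<le> b" by (simp_all add: a_def b_def)
  have "c\<^sup>2 \<le> a * b"
  proof (cases "b = 0")
    case True
    have "c = 0"
    proof (rule ccontr)
      assume "c \<noteq> 0"
      then show False
        \<comment> \<open>With \<open>b = 0\<close> the quadratic takes the value a - (a + 1) = -1
          here.\<close>
        using quad[of 1 "(a + 1) / (2 * c)"] True by simp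
    qed
    then show ?thesis using True by simp
  next
    case False
    have "0 \<le> b * (a * b - c\<^sup>2)"
      using quad[of b c] by (simp add: power2_eq_square algebra_simps)
    then show ?thesis
      using False nn by (simp add: zero_le_mult_iff)
  qed
  then have "c\<^sup>2 \<le> (A_seminorm A x * A_seminorm A y)\<^sup>2"
    by (simp add: a_def b_def power_mult_distrib)
  then show ?thesis
    unfolding c_def by (rule power2_le_imp_le) simp
qed

text \<open>A unimodular factor on \<open>x\<close> makes the form real and nonnegative without
  changing the seminorm.\<close>

lemma A_inner_bound: "cmod (A_inner A x y) \<le> A_seminorm A x * A_seminorm A y"
proof (cases "A_inner A x y = 0")
  case False
  define c where "c = cnj (A_inner A x y) / cmod (A_inner A x y)"
  have "cmod c = 1" using False by (simp add: c_def norm_divide)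
  moreover have "A_inner A (c *\<^sub>C x) y = complex_of_real (cmod (A_inner A x y))"
    using False complex_norm_square[of "A_inner A x y"]
    by (simp add: A_inner_simps c_def field_simps power2_eq_square)
  ultimately show ?thesis
    using A_inner_Re_bound[of "c *\<^sub>C x" y] by (simp add: A_seminorm_scaleC)
qed simp

lemma A_seminorm_le_norm: "\<exists>K\<ge>0. \<forall>x. A_seminorm A x \<le> K * norm x"
proof -
  note bl = bounded_clinearD(1)[OF bounded_clinear_A]
  have "A_seminorm A x \<le> sqrt (onorm A) * norm x" for x
  proof -
    have "Re (A_inner A x x) = inner (A x) x"
      by (simp add: A_inner_def inner_eq_Re_cinner)
    also have "\<dots> \<le> norm (A x) * norm x" by (rule norm_cauchy_schwarz)
    also have "\<dots> \<le> (onorm A * norm x) * norm x"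
      by (intro mult_right_mono onorm bl) simp
    finally have "sqrt (Re (A_inner A x x)) \<le> sqrt (onorm A * (norm x)\<^sup>2)"
      by (intro real_sqrt_le_mono) (simp add: power2_eq_square mult.assoc)
    then show ?thesis
      by (simp add: A_seminorm_def real_sqrt_mult)
  qed
  then show ?thesis using onorm_pos_le[OF bl] by (intro exI[of _ "sqrt (onorm A)"]) simp
qed

lemma A_seminorm_parallelogram:
  "(A_seminorm A (x + y))\<^sup>2 + (A_seminorm A (x - y))\<^sup>2 = 2 * (A_seminorm A x)\<^sup>2 + 2 * (A_seminorm A y)\<^sup>2"
  by (simp add: A_seminorm_power2 A_inner_simps)

lemma A_seminorm_add_null:
  assumes "A_seminorm A z = 0"
  shows "A_seminorm A (u + z) = A_seminorm A u"
proof -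
  have "A_inner A u z = 0" "A_inner A z u = 0" "A_inner A z z = 0"
    using A_inner_bound[of u z] A_inner_bound[of z u] A_inner_bound[of z z] assms by simp_all
  then show ?thesis by (simp add: A_seminorm_def A_inner_simps)
qed

section \<open>Operators with an adjoint for the semi-inner product\<close>

text \<open>Without a range condition on \<open>S'\<close> the relation is symmetric and stable
  under composition and sums. It lets \<open>A_Re A T\<close> be paired with itself although its
  range may leave the closure of the range of \<open>A\<close>.\<close>

definition adjoint_pair :: "('a \<Rightarrow> 'a) \<Rightarrow> ('a \<Rightarrow> 'a) \<Rightarrow> bool" where
  "adjoint_pair S S' \<longleftrightarrow> bounded_clinear S \<and> bounded_clinear S' \<and>
    (\<forall>x y. A_inner A (S x) y = A_inner A x (S' y))"

lemma adjoint_pairD: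
  assumes "adjoint_pair S S'"
  shows "bounded_clinear S" "bounded_clinear S'" "A_inner A (S x) y = A_inner A x (S' y)"
    "A_inner A (S' x) y = A_inner A x (S y)"
  using assms A_inner_commute[of "S' x" y] A_inner_commute[of x "S y"]
  unfolding adjoint_pair_def by auto

lemma A_seminorm_null:
  assumes S: "adjoint_pair S S'" and z: "A_seminorm A z = 0"
  shows "A_seminorm A (S z) = 0"
proof -
  have "A_inner A (S z) (S z) = A_inner A z (S' (S z))"
    by (rule adjoint_pairD(3)[OF S])
  also have "\<dots> = 0"
    using A_inner_bound[of z "S' (S z)"] z by simp
  finally show ?thesis by (simp add: A_seminorm_def)
qed

text \<open>By Cauchy--Schwarz, \<open>n \<mapsto> \<parallel>S\<^sup>n x\<parallel>\<^sub>A\<close> is logarithmically convex. If its first ratio exceeded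
  the operator norm of \<open>S\<close>, the sequence would outgrow the bound \<open>C \<parallel>S\<parallel>\<^sup>n \<parallel>x\<parallel>\<close>.\<close>

lemma symmetric_A_bounded:
  assumes S: "adjoint_pair S S"
  shows "\<exists>K\<ge>0. \<forall>x. A_seminorm A (S x) \<le> K * A_seminorm A x"
proof -
  \<comment> \<open>The summand 1 makes \<open>K\<close> positive even for \<open>S = 0\<close>, so
    that \<open>r / K\<close> is meaningful.\<close>
  define K where "K = onorm S + 1"
  have bl: "bounded_linear S" using bounded_clinearD(1) adjoint_pairD(1)[OF S] by blast
  have K: "K > 0" using onorm_pos_le[OF bl] by (simp add: K_def)
  have SK: "norm (S x) \<le> K * norm x" for x
  proof -
    have "norm (S x) \<le> onorm S * norm x" by (rule onorm[OF bl])
    then show ?thesis unfolding K_def distrib_right by (simp add: add_increasing2)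
  qed
  obtain C where C: "C \<ge> 0" "\<And>x. A_seminorm A x \<le> C * norm x"
    using A_seminorm_le_norm by blast
  have "A_seminorm A (S x) \<le> K * A_seminorm A x" for x
  proof (rule ccontr)
    assume "\<not> ?thesis"
    then have gt: "K * A_seminorm A x < A_seminorm A (S x)" by simp
    define a where "a n = A_seminorm A ((S ^^ n) x)" for n
    have a_nonneg: "0 \<le> a n" for n by (simp add: a_def)
    have a0: "a 0 > 0"
    proof (rule ccontr)
      assume "\<not> a 0 > 0"
      then have "A_seminorm A x = 0" using a_nonneg[of 0] by (simp add: a_def order_less_le)
      then show False using A_seminorm_null[OF S] gt by fastforce
    qed
    define r where "r = a 1 / a 0"
    have rK: "K < r" using gt a0 by (simp add: r_def a_def field_simps)
    have logconvex: "(a (Suc n))\<^sup>2 \<le> a n * a (Suc (Suc n))" for n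
    proof -
      have "complex_of_real ((a (Suc n))\<^sup>2) = A_inner A ((S ^^ n) x) ((S ^^ Suc (Suc n)) x)"
        unfolding a_def A_inner_self[symmetric] by (simp add: adjoint_pairD(3)[OF S])
      then have "cmod (complex_of_real ((a (Suc n))\<^sup>2)) \<le> a n * a (Suc (Suc n))"
        using A_inner_bound[of "(S ^^ n) x" "(S ^^ Suc (Suc n)) x"] unfolding a_def by metis
      then show ?thesis by (simp only: norm_of_real abs_of_nonneg zero_le_power2)
    qed
    have step: "0 < a n \<and> r * a n \<le> a (Suc n)" for n
    proof (induction n)
      case 0
      then show ?case using a0 by (simp add: r_def)
    next
      case (Suc n)
      have "0 < r * a n" using Suc rK K by (intro mult_pos_pos) auto
      then have pos: "0 < a (Suc n)" using Suc by linarith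
      \<comment> \<open>Chained with logarithmic convexity, after which the positive factor
        \<open>a n\<close> cancels: the ratio bound passes to the next index.\<close>
      have "(r * a (Suc n)) * a n \<le> a (Suc n) * a (Suc n)"
        using Suc pos mult_right_mono[of "r * a n" "a (Suc n)" "a (Suc n)"]
        by (simp add: algebra_simps)
      also have "\<dots> \<le> a (Suc (Suc n)) * a n"
        using logconvex[of n] by (simp add: power2_eq_square mult.commute)
      finally show ?case using Suc pos by simp
    qed
    have lower: "r ^ n * a 0 \<le> a n" for n
    proof (induction n)
      case (Suc n)
      have "r * (r ^ n * a 0) \<le> r * a n"
        using Suc rK K by (intro mult_left_mono) auto
      then show ?case using step[of n] by (simp add: mult.assoc)
    qed simp
    have upper: "a n \<le> C * (K ^ n * norm x)" for n
    proof -
      have "norm ((S ^^ n) x) \<le> K ^ n * norm x"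
      proof (induction n)
        case (Suc n)
        have "norm (S ((S ^^ n) x)) \<le> K * norm ((S ^^ n) x)" by (rule SK)
        also have "\<dots> \<le> K * (K ^ n * norm x)" using Suc K by (intro mult_left_mono) auto
        finally show ?case by (simp add: mult.assoc)
      qed simp
      then have "C * norm ((S ^^ n) x) \<le> C * (K ^ n * norm x)"
        using C(1) by (rule mult_left_mono)
      then show ?thesis using C(2)[of "(S ^^ n) x"] by (simp add: a_def)
    qed
    obtain n where "C * norm x / a 0 < (r / K) ^ n"
      using real_arch_pow[of "r / K"] rK K by (metis less_divide_eq_1_pos)
    moreover have "r ^ n * a 0 \<le> C * (K ^ n * norm x)"
      using lower upper order_trans by blast
    ultimately show False
      using a0 K by (simp add: power_divide field_simps)
  qed
  then show ?thesis using K by (intro exI[of _ K]) auto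
qed

text \<open>Reduction to the symmetric operator S'S, by |Sx|_A^2 = <x, S'Sx>_A and Cauchy-Schwarz;
  hence the square root of its bound.\<close>

lemma A_bounded:
  assumes S: "adjoint_pair S S'"
  shows "\<exists>K\<ge>0. \<forall>x. A_seminorm A (S x) \<le> K * A_seminorm A x"
proof -
  note b = bounded_clinearD(1)[OF adjoint_pairD(1)[OF S]] bounded_clinearD(1)[OF adjoint_pairD(2)[OF S]]
  have "bounded_clinear (\<lambda>x. S' (S x))"
    using bounded_linear_compose[OF b(2,1)] bounded_clinearD(2) adjoint_pairD(1,2)[OF S]
    by (simp add: bounded_clinear_def)
  then have "adjoint_pair (\<lambda>x. S' (S x)) (\<lambda>x. S' (S x))"
    using adjoint_pairD(3,4)[OF S] by (simp add: adjoint_pair_def)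
  then obtain K where K: "K \<ge> 0" "\<And>x. A_seminorm A (S' (S x)) \<le> K * A_seminorm A x"
    using symmetric_A_bounded by blast
  have "A_seminorm A (S x) \<le> sqrt K * A_seminorm A x" for x
  proof -
    have "complex_of_real ((A_seminorm A (S x))\<^sup>2) = A_inner A x (S' (S x))"
      by (metis A_inner_self adjoint_pairD(3)[OF S])
    then have "cmod (complex_of_real ((A_seminorm A (S x))\<^sup>2)) \<le> A_seminorm A x * A_seminorm A (S' (S x))"
      using A_inner_bound[of x "S' (S x)"] by metis
    then have "(A_seminorm A (S x))\<^sup>2 \<le> A_seminorm A x * A_seminorm A (S' (S x))"
      by (simp only: norm_of_real abs_of_nonneg zero_le_power2)
    also have "\<dots> \<le> A_seminorm A x * (K * A_seminorm A x)"
      by (intro mult_left_mono K) simp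
    also have "\<dots> = (sqrt K * A_seminorm A x)\<^sup>2"
      using K(1) by (simp add: power_mult_distrib power2_eq_square[of "A_seminorm A x"])
    finally show ?thesis
      by (rule power2_le_imp_le) (simp add: K(1))
  qed
  then show ?thesis using K(1) by (intro exI[of _ "sqrt K"]) simp
qed

section \<open>The suprema as operator bounds\<close>

text \<open>The supremum sees only vectors in the closure of the range. The kernel component of a
  general \<open>x\<close> has seminorm 0, and so has its image under \<open>S\<close>, so dropping
  it changes neither side.\<close>

lemma A_norm_nonneg_and_bound:
  assumes S: "adjoint_pair S S'"
  shows "0 \<le> A_norm A S" "A_seminorm A (S x) \<le> A_norm A S * A_seminorm A x"
proof -
  let ?N = "insert 0 {A_seminorm A (S x) |x. x \<in> closure (range A) \<and> A_seminorm A x = 1}"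
  obtain K where K: "K \<ge> 0" "\<And>x. A_seminorm A (S x) \<le> K * A_seminorm A x"
    using A_bounded[OF S] by blast
  have bdd: "bdd_above ?N"
  proof (rule bdd_aboveI[of _ K])
    have "A_seminorm A (S x) \<le> K" if "A_seminorm A x = 1" for x
      using K(2)[of x] that by simp
    then show "t \<le> K" if "t \<in> ?N" for t
      using that K(1) by auto
  qed
  show nonneg: "0 \<le> A_norm A S"
    unfolding A_norm_def by (rule cSup_upper[OF _ bdd]) simp
  show "A_seminorm A (S x) \<le> A_norm A S * A_seminorm A x"
  proof (cases "A_seminorm A x = 0")
    case True
    then show ?thesis using A_seminorm_null[OF S] by simp
  next
    case False
    obtain u z where x: "x = u + z" and u: "u \<in> closure (range A)" and z: "A z = 0"
      by (rule kernel_range_decomposition)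
    have null: "A_seminorm A z = 0" by (simp add: A_seminorm_def A_inner_def z)
    have xu: "A_seminorm A x = A_seminorm A u"
      using A_seminorm_add_null[OF null] x by simp
    have Sxu: "A_seminorm A (S x) = A_seminorm A (S u)"
      using A_seminorm_add_null[OF A_seminorm_null[OF S null]] x
      by (simp add: bounded_clinearD(3)[OF adjoint_pairD(1)[OF S]])
    define v where "v = (1 / A_seminorm A u) *\<^sub>R u"
    have "v \<in> closure (range A)"
      unfolding v_def by (intro subspace_scale subspace_closure_range u)
    moreover have "A_seminorm A v = 1"
      using False xu by (simp add: v_def A_seminorm_scaleR)
    ultimately have "A_seminorm A (S v) \<le> A_norm A S"
      unfolding A_norm_def by (intro cSup_upper[OF _ bdd]) blast
    moreover have "S v = (1 / A_seminorm A u) *\<^sub>R S u"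
      unfolding v_def
      by (simp add: bounded_linear.linear linear_cmul bounded_clinearD(1)[OF adjoint_pairD(1)[OF S]])
    ultimately have "A_seminorm A (S u) / A_seminorm A u \<le> A_norm A S"
      by (simp add: A_seminorm_scaleR)
    moreover have "A_seminorm A u > 0"
      using False xu by (metis A_seminorm_nonneg order_le_less)
    ultimately show ?thesis
      by (simp add: Sxu xu field_simps)
  qed
qed

lemma A_norm_le:
  assumes "0 \<le> k" "\<And>x. A_seminorm A (S x) \<le> k * A_seminorm A x"
  shows "A_norm A S \<le> k"
  unfolding A_norm_def
proof (rule cSup_least)
  have "A_seminorm A (S x) \<le> k" if "A_seminorm A x = 1" for x
    using assms(2)[of x] that by simp
  then show "t \<le> k" if "t \<in> insert 0 {A_seminorm A (S x) |x. x \<in> closure (range A) \<and> A_seminorm A x = 1}" for t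
    using that assms(1) by auto
qed simp

lemma A_num_radius_nonneg_and_bound:
  assumes S: "adjoint_pair S S'"
  shows "0 \<le> A_num_radius A S" "cmod (A_inner A (S x) x) \<le> A_num_radius A S * (A_seminorm A x)\<^sup>2"
proof -
  let ?W = "insert 0 {cmod (A_inner A (S x) x) |x. A_seminorm A x = 1}"
  have bdd: "bdd_above ?W"
  proof (rule bdd_aboveI[of _ "A_norm A S"])
    have "cmod (A_inner A (S x) x) \<le> A_norm A S" if "A_seminorm A x = 1" for x
      using A_inner_bound[of "S x" x] A_norm_nonneg_and_bound(2)[OF S, of x] that by simp
    then show "t \<le> A_norm A S" if "t \<in> ?W" for t
      using that A_norm_nonneg_and_bound(1)[OF S] by auto
  qed
  show nonneg: "0 \<le> A_num_radius A S"
    unfolding A_num_radius_def by (rule cSup_upper[OF _ bdd]) simp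
  show "cmod (A_inner A (S x) x) \<le> A_num_radius A S * (A_seminorm A x)\<^sup>2"
  proof (cases "A_seminorm A x = 0")
    case True
    then show ?thesis using A_inner_bound[of "S x" x] by simp
  next
    case False
    define c where "c = complex_of_real (1 / A_seminorm A x)"
    have "A_seminorm A (c *\<^sub>C x) = 1"
      using False by (simp add: c_def A_seminorm_scaleC norm_divide)
    then have "cmod (A_inner A (S (c *\<^sub>C x)) (c *\<^sub>C x)) \<le> A_num_radius A S"
      unfolding A_num_radius_def by (intro cSup_upper[OF _ bdd]) blast
    then have "cmod (A_inner A (S x) x) / (A_seminorm A x)\<^sup>2 \<le> A_num_radius A S"
      by (simp add: bounded_clinearD(2)[OF adjoint_pairD(1)[OF S]] A_inner_simps norm_mult c_def
          norm_divide power2_eq_square)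
    then show ?thesis using False by (simp add: field_simps)
  qed
qed

lemma A_num_radius_le:
  assumes "0 \<le> k" "\<And>x. A_seminorm A x = 1 \<Longrightarrow> cmod (A_inner A (S x) x) \<le> k"
  shows "A_num_radius A S \<le> k"
  unfolding A_num_radius_def using assms by (intro cSup_least) auto

text \<open>Polarization bounds \<open>Re \<langle>S x, y\<rangle>\<^sub>A\<close>; then \<open>y\<close> is taken to be \<open>S x\<close>, rescaled to
  the seminorm of \<open>x\<close>.\<close>

lemma symmetric_seminorm_le:
  assumes S: "adjoint_pair S S"
    and k: "\<And>x. cmod (A_inner A (S x) x) \<le> k * (A_seminorm A x)\<^sup>2"
  shows "A_seminorm A (S x) \<le> k * A_seminorm A x"
proof (cases "A_seminorm A x = 0 \<or> A_seminorm A (S x) = 0")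
  case True
  show ?thesis
  proof (cases "A_seminorm A x = 0")
    case True
    then show ?thesis using A_seminorm_null[OF S] by simp
  next
    case False
    \<comment> \<open>The hypothesis at \<open>x\<close> yields the sign of \<open>k\<close>, which
      the claim needs when the left side vanishes.\<close>
    have "0 \<le> k * (A_seminorm A x)\<^sup>2"
      using k[of x] norm_ge_zero order_trans by blast
    then have "0 \<le> k" using False by (simp add: zero_le_mult_iff)
    then show ?thesis using True False by simp
  qed
next
  case False
  let ?N = "A_seminorm A"
  have polar: "2 * Re (A_inner A (S x) y) \<le> k * ((?N x)\<^sup>2 + (?N y)\<^sup>2)" for y
  proof -
    have "Re (A_inner A (S y) x) = Re (A_inner A (S x) y)"
      using adjoint_pairD(3)[OF S, of y x] A_inner_commute[of y "S x"] by simp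
    then have "4 * Re (A_inner A (S x) y) =
        Re (A_inner A (S (x + y)) (x + y)) - Re (A_inner A (S (x - y)) (x - y))"
      by (simp add: bounded_clinearD[OF adjoint_pairD(1)[OF S]] A_inner_simps)
    also have "\<dots> \<le> cmod (A_inner A (S (x + y)) (x + y)) + cmod (A_inner A (S (x - y)) (x - y))"
      using complex_Re_le_cmod[of "A_inner A (S (x + y)) (x + y)"]
        abs_Re_le_cmod[of "A_inner A (S (x - y)) (x - y)"] by linarith
    also have "\<dots> \<le> k * ((?N (x + y))\<^sup>2 + (?N (x - y))\<^sup>2)"
      using k[of "x + y"] k[of "x - y"] by (simp add: distrib_left)
    also have "\<dots> = 2 * (k * ((?N x)\<^sup>2 + (?N y)\<^sup>2))"
      unfolding A_seminorm_parallelogram by (simp add: algebra_simps)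
    finally show ?thesis by simp
  qed
  have pos: "?N x > 0" "?N (S x) > 0"
    using False A_seminorm_nonneg order_le_less by metis+
  define t where "t = ?N x / ?N (S x)"
  have "Re (A_inner A (S x) (complex_of_real t *\<^sub>C S x)) = t * (?N (S x))\<^sup>2"
    by (simp add: A_inner_simps A_seminorm_power2)
  also have "\<dots> = ?N x * ?N (S x)"
    using pos by (simp add: t_def power2_eq_square)
  finally have "2 * (?N x * ?N (S x)) \<le> k * ((?N x)\<^sup>2 + (?N (complex_of_real t *\<^sub>C S x))\<^sup>2)"
    using polar[of "complex_of_real t *\<^sub>C S x"] by simp
  also have "?N (complex_of_real t *\<^sub>C S x) = ?N x"
    unfolding scaleC_of_real A_seminorm_scaleR using pos by (simp add: t_def)
  finally have "?N (S x) * ?N x \<le> (k * ?N x) * ?N x"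
    by (simp add: power2_eq_square algebra_simps)
  then show ?thesis using pos by simp
qed

section \<open>The inequalities\<close>

text \<open><ATx, y> = <Tx, Ay> = <x, T*Ay> = <x, AT'y>: the defining equation AT' = T*A is
  adjointness for the form.\<close>

lemma adjoint_pair_A_adjoint:
  assumes T: "T \<in> A_ops A"
  shows "adjoint_pair T (A_adjoint A T)"
proof -
  have bT: "bounded_clinear T" using T by (simp add: A_ops_def)
  have "A_inner A (T x) y = A_inner A x (A_adjoint A T y)" for x y
    by (simp add: A_inner_def A_self_adjoint A_adjoint_spec(2)[OF T] cinner_cadjoint[OF bT])
  then show ?thesis
    using bT A_adjoint_spec(1)[OF T] by (simp add: adjoint_pair_def)
qed

text \<open>From |S'x|_A^2 = <SS'x, x>_A, cancelling one factor. It is applied to the adjoint of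
  \<open>Y\<close>, whose size is thus measured by the A-norm of \<open>Y\<close> itself.\<close>

lemma A_seminorm_adjoint_le:
  assumes S: "adjoint_pair S S'"
  shows "A_seminorm A (S' x) \<le> A_norm A S * A_seminorm A x"
proof (cases "A_seminorm A (S' x) = 0")
  case True
  then show ?thesis using A_norm_nonneg_and_bound(1)[OF S] by simp
next
  case False
  have "complex_of_real ((A_seminorm A (S' x))\<^sup>2) = A_inner A (S (S' x)) x"
    by (metis A_inner_self adjoint_pairD(3)[OF S])
  then have "cmod (complex_of_real ((A_seminorm A (S' x))\<^sup>2)) \<le> A_seminorm A (S (S' x)) * A_seminorm A x"
    using A_inner_bound[of "S (S' x)" x] by metis
  then have "(A_seminorm A (S' x))\<^sup>2 \<le> A_seminorm A (S (S' x)) * A_seminorm A x"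
    by (simp only: norm_of_real abs_of_nonneg zero_le_power2)
  also have "\<dots> \<le> (A_norm A S * A_seminorm A (S' x)) * A_seminorm A x"
    by (intro mult_right_mono A_norm_nonneg_and_bound(2)[OF S]) simp
  finally have "A_seminorm A (S' x) * A_seminorm A (S' x)
      \<le> A_seminorm A (S' x) * (A_norm A S * A_seminorm A x)"
    by (simp add: power2_eq_square algebra_simps)
  moreover have "A_seminorm A (S' x) > 0"
    using False A_seminorm_nonneg order_le_less by metis
  ultimately show ?thesis by simp
qed

text \<open>One shape for four operators: (c, d) is (1/2, 1) for the real part, (1/(2i), -1) for the
  imaginary part, and (1, 1) or (1, -1) for sums and differences.\<close>

lemma bounded_clinear_scaleC_add:
  assumes "bounded_clinear S" "bounded_clinear S'"
  shows "bounded_clinear (\<lambda>x. c *\<^sub>C (S x + d *\<^sub>C S' x))"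
proof -
  have "bounded_linear (\<lambda>x. c *\<^sub>C (S x + d *\<^sub>C S' x))"
    by (intro bounded_linear_compose[OF bounded_linear_scaleC] bounded_linear_add
        bounded_clinearD(1) assms)
  then show ?thesis
    by (simp add: bounded_clinear_def bounded_clinearD(2)[OF assms(1)] bounded_clinearD(2)[OF assms(2)]
        scaleC_add_right scaleC_scaleC mult.commute mult.left_commute)
qed

lemma adjoint_pair_linear_combination:
  assumes S: "adjoint_pair S S" and R: "adjoint_pair R R"
  shows "adjoint_pair (\<lambda>x. S x + R x) (\<lambda>x. S x + R x)" "adjoint_pair (\<lambda>x. S x - R x) (\<lambda>x. S x - R x)"
  using bounded_clinear_scaleC_add[OF adjoint_pairD(1)[OF S] adjoint_pairD(1)[OF R], of 1 1]
    bounded_clinear_scaleC_add[OF adjoint_pairD(1)[OF S] adjoint_pairD(1)[OF R], of 1 "-1"]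
  by (simp_all add: adjoint_pair_def scaleC_one scaleC_minus_one A_inner_simps adjoint_pairD(3)[OF S]
      adjoint_pairD(3)[OF R])

section \<open>Real and imaginary parts and their A-norms\<close>

lemma A_Re_A_Im_decomposition:
  "A_Re A T x + \<i> *\<^sub>C A_Im A T x = T x" "A_Re A T x - \<i> *\<^sub>C A_Im A T x = A_adjoint A T x"
proof -
  have half: "(1/2) *\<^sub>C (y::'a) = (1/2) *\<^sub>R y" for y
    using scaleC_of_real[of "1/2" y] by simp
  show "A_Re A T x + \<i> *\<^sub>C A_Im A T x = T x" "A_Re A T x - \<i> *\<^sub>C A_Im A T x = A_adjoint A T x"
    by (simp_all add: A_Re_def A_Im_def scaleC_scaleC half scaleR_add_right[symmetric]
        scaleR_diff_right[symmetric] scaleR_2[symmetric])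
qed

lemma adjoint_pair_A_Re:
  assumes T: "T \<in> A_ops A"
  shows "adjoint_pair (A_Re A T) (A_Re A T)"
proof -
  note p = adjoint_pairD[OF adjoint_pair_A_adjoint[OF T]]
  have "bounded_clinear (A_Re A T)"
    using bounded_clinear_scaleC_add[OF p(1,2), of "1/2" 1]
    by (simp add: A_Re_def[abs_def] scaleC_one)
  then show ?thesis
    by (simp add: adjoint_pair_def A_Re_def A_inner_simps p(3,4))
qed

text \<open>Passing to the adjoint exchanges T and T' and so reverses the sign of T - T';
  conjugating 1/(2i) reverses it back.\<close>

lemma adjoint_pair_A_Im:
  assumes T: "T \<in> A_ops A"
  shows "adjoint_pair (A_Im A T) (A_Im A T)"
proof -
  note p = adjoint_pairD[OF adjoint_pair_A_adjoint[OF T]]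
  have "bounded_clinear (A_Im A T)"
    using bounded_clinear_scaleC_add[OF p(1,2), of "1/(2*\<i>)" "-1"]
    by (simp add: A_Im_def[abs_def] scaleC_minus_one)
  then show ?thesis
    by (simp add: adjoint_pair_def A_Im_def A_inner_simps p(3,4) algebra_simps)
qed

lemma symmetric_form_real:
  assumes "adjoint_pair S S"
  shows "Im (A_inner A (S x) x) = 0"
  using arg_cong[OF A_inner_commute[of x "S x"], of Im] by (simp add: adjoint_pairD(3)[OF assms])

lemma A_Re_A_Im_form:
  assumes T: "T \<in> A_ops A"
  shows "(cmod (A_inner A (T x) x))\<^sup>2 =
    (Re (A_inner A (A_Re A T x) x))\<^sup>2 + (Re (A_inner A (A_Im A T x) x))\<^sup>2"
proof -
  have "A_inner A (T x) x = A_inner A (A_Re A T x) x + \<i> * A_inner A (A_Im A T x) x"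
    by (subst A_Re_A_Im_decomposition(1)[symmetric]) (simp add: A_inner_simps)
  then show ?thesis
    by (simp add: cmod_power2 symmetric_form_real[OF adjoint_pair_A_Re[OF T]]
        symmetric_form_real[OF adjoint_pair_A_Im[OF T]])
qed

lemma seminorm_sum_squares:
  "(A_seminorm A (T x))\<^sup>2 + (A_seminorm A (A_adjoint A T x))\<^sup>2 =
    2 * (A_seminorm A (A_Re A T x))\<^sup>2 + 2 * (A_seminorm A (A_Im A T x))\<^sup>2"
  using A_seminorm_parallelogram[of "A_Re A T x" "\<i> *\<^sub>C A_Im A T x"]
  by (simp add: A_Re_A_Im_decomposition A_seminorm_scaleC)

lemma symmetric_A_norm_le:
  assumes S: "adjoint_pair S S" and k: "0 \<le> k"
    and le: "\<And>x. \<bar>Re (A_inner A (S x) x)\<bar> \<le> k * (A_seminorm A x)\<^sup>2"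
  shows "A_norm A S \<le> k"
proof (intro A_norm_le k symmetric_seminorm_le S)
  show "cmod (A_inner A (S x) x) \<le> k * (A_seminorm A x)\<^sup>2" for x
    using le[of x] by (simp add: cmod_eq_Re symmetric_form_real[OF S])
qed

lemma A_norm_Re_Im_le:
  assumes T: "T \<in> A_ops A"
  shows "A_norm A (A_Re A T) \<le> A_num_radius A T" "A_norm A (A_Im A T) \<le> A_num_radius A T"
proof -
  note w = A_num_radius_nonneg_and_bound[OF adjoint_pair_A_adjoint[OF T]]
  have "\<bar>Re (A_inner A (A_Re A T x) x)\<bar> \<le> cmod (A_inner A (T x) x)"
    "\<bar>Re (A_inner A (A_Im A T x) x)\<bar> \<le> cmod (A_inner A (T x) x)" for x
    by (rule power2_le_imp_le; simp add: A_Re_A_Im_form[OF T])+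
  then show "A_norm A (A_Re A T) \<le> A_num_radius A T" "A_norm A (A_Im A T) \<le> A_num_radius A T"
    by (intro symmetric_A_norm_le adjoint_pair_A_Re[OF T] adjoint_pair_A_Im[OF T] w(1)
        order_trans[OF _ w(2)]; blast)+
qed

text \<open>With <Tx, x>_A = p + iq for real p, q, the form of the sum or difference is p + q or p -
  q, and (p \<plusminus> q)^2 \<le> 2 (p^2 + q^2); this is the source of sqrt 2.\<close>

lemma A_norm_Re_pm_Im_le:
  assumes T: "T \<in> A_ops A"
  shows "A_norm A (\<lambda>x. A_Re A T x + A_Im A T x) \<le> sqrt 2 * A_num_radius A T"
    "A_norm A (\<lambda>x. A_Re A T x - A_Im A T x) \<le> sqrt 2 * A_num_radius A T"
proof -
  note w = A_num_radius_nonneg_and_bound[OF adjoint_pair_A_adjoint[OF T]]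
  note pair = adjoint_pair_linear_combination[OF adjoint_pair_A_Re[OF T] adjoint_pair_A_Im[OF T]]
  have abs_le: "\<bar>p + q\<bar> \<le> sqrt 2 * c" "\<bar>p - q\<bar> \<le> sqrt 2 * c"
    if "c\<^sup>2 = p\<^sup>2 + q\<^sup>2" "0 \<le> c" for p q c :: real
  proof -
    have "(p + q)\<^sup>2 \<le> 2 * c\<^sup>2" "(p - q)\<^sup>2 \<le> 2 * c\<^sup>2"
      unfolding that(1) using zero_le_power2[of "p - q"] zero_le_power2[of "p + q"]
      by (simp_all add: power2_eq_square algebra_simps)
    then have "\<bar>p + q\<bar>\<^sup>2 \<le> (sqrt 2 * c)\<^sup>2" "\<bar>p - q\<bar>\<^sup>2 \<le> (sqrt 2 * c)\<^sup>2"
      by (simp_all add: power_mult_distrib)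
    then show "\<bar>p + q\<bar> \<le> sqrt 2 * c" "\<bar>p - q\<bar> \<le> sqrt 2 * c"
      using that(2) by (auto intro: power2_le_imp_le)
  qed
  have w2: "sqrt 2 * cmod (A_inner A (T x) x) \<le> sqrt 2 * A_num_radius A T * (A_seminorm A x)\<^sup>2" for x
    using w(2)[of x] by simp
  have k: "0 \<le> sqrt 2 * A_num_radius A T" using w(1) by simp
  show "A_norm A (\<lambda>x. A_Re A T x + A_Im A T x) \<le> sqrt 2 * A_num_radius A T"
    using order_trans[OF abs_le(1)[OF A_Re_A_Im_form[OF T] norm_ge_zero] w2]
    by (intro symmetric_A_norm_le[OF pair(1) k]) (simp add: A_inner_simps)
  show "A_norm A (\<lambda>x. A_Re A T x - A_Im A T x) \<le> sqrt 2 * A_num_radius A T"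
    using order_trans[OF abs_le(2)[OF A_Re_A_Im_form[OF T] norm_ge_zero] w2]
    by (intro symmetric_A_norm_le[OF pair(2) k]) (simp add: A_inner_simps)
qed

lemma A_norm_Re_Im_power2_le:
  assumes T: "T \<in> A_ops A"
  shows "(A_norm A (A_Re A T))\<^sup>2 \<le> (A_num_radius A T)\<^sup>2"
    "(A_norm A (A_Im A T))\<^sup>2 \<le> (A_num_radius A T)\<^sup>2"
  using A_norm_Re_Im_le[OF T] A_norm_nonneg_and_bound(1)[OF adjoint_pair_A_Re[OF T]]
    A_norm_nonneg_and_bound(1)[OF adjoint_pair_A_Im[OF T]]
  by (auto intro!: power_mono)

lemma A_norm_Re_pm_Im_power2_le:
  assumes T: "T \<in> A_ops A"
  shows "(A_norm A (\<lambda>x. A_Re A T x + A_Im A T x))\<^sup>2 \<le> 2 * (A_num_radius A T)\<^sup>2"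
    "(A_norm A (\<lambda>x. A_Re A T x - A_Im A T x))\<^sup>2 \<le> 2 * (A_num_radius A T)\<^sup>2"
proof -
  note pm = adjoint_pair_linear_combination[OF adjoint_pair_A_Re[OF T] adjoint_pair_A_Im[OF T]]
  have "(sqrt 2 * A_num_radius A T)\<^sup>2 = 2 * (A_num_radius A T)\<^sup>2"
    by (simp add: power_mult_distrib)
  then show "(A_norm A (\<lambda>x. A_Re A T x + A_Im A T x))\<^sup>2 \<le> 2 * (A_num_radius A T)\<^sup>2"
    "(A_norm A (\<lambda>x. A_Re A T x - A_Im A T x))\<^sup>2 \<le> 2 * (A_num_radius A T)\<^sup>2"
    using power_mono[OF A_norm_Re_pm_Im_le(1)[OF T] A_norm_nonneg_and_bound(1)[OF pm(1)], of 2]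
      power_mono[OF A_norm_Re_pm_Im_le(2)[OF T] A_norm_nonneg_and_bound(1)[OF pm(2)], of 2]
    by simp_all
qed

section \<open>Pointwise bounds and passage to the numerical radius\<close>

text \<open>For the squared norms a, b \<le> w^2 one has 2(a + b) = 4 max(a, b) - 2|a - b| \<le> 4
  (w^2 - |a - b|/2).\<close>

lemma seminorm_sum_squares_Re_Im:
  assumes T: "T \<in> A_ops A" and x: "A_seminorm A x = 1"
  shows "(A_seminorm A (T x))\<^sup>2 + (A_seminorm A (A_adjoint A T x))\<^sup>2 \<le>
    4 * ((A_num_radius A T)\<^sup>2 - \<bar>(A_norm A (A_Re A T))\<^sup>2 - (A_norm A (A_Im A T))\<^sup>2\<bar> / 2)"
proof -
  note re = A_norm_nonneg_and_bound[OF adjoint_pair_A_Re[OF T]]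
  note im = A_norm_nonneg_and_bound[OF adjoint_pair_A_Im[OF T]]
  have "(A_seminorm A (A_Re A T x))\<^sup>2 \<le> (A_norm A (A_Re A T))\<^sup>2"
    "(A_seminorm A (A_Im A T x))\<^sup>2 \<le> (A_norm A (A_Im A T))\<^sup>2"
    using re(2)[of x] im(2)[of x] x by (auto intro!: power_mono)
  with A_norm_Re_Im_power2_le[OF T] show ?thesis
    unfolding seminorm_sum_squares by (simp add: abs_if)
qed

text \<open>Here a, b \<le> 2w^2 and the sum is bounded by a + b itself, so a + b \<le> 4w^2 - |a -
  b|; hence the divisor 4 in place of 2.\<close>

lemma seminorm_sum_squares_Re_pm_Im:
  assumes T: "T \<in> A_ops A" and x: "A_seminorm A x = 1"
  shows "(A_seminorm A (T x))\<^sup>2 + (A_seminorm A (A_adjoint A T x))\<^sup>2 \<le>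
    4 * ((A_num_radius A T)\<^sup>2 - \<bar>(A_norm A (\<lambda>x. A_Re A T x + A_Im A T x))\<^sup>2
      - (A_norm A (\<lambda>x. A_Re A T x - A_Im A T x))\<^sup>2\<bar> / 4)"
proof -
  let ?P = "\<lambda>x. A_Re A T x + A_Im A T x" and ?M = "\<lambda>x. A_Re A T x - A_Im A T x"
  note pair = adjoint_pair_linear_combination[OF adjoint_pair_A_Re[OF T] adjoint_pair_A_Im[OF T]]
  note p = A_norm_nonneg_and_bound[OF pair(1)] and m = A_norm_nonneg_and_bound[OF pair(2)]
  have "(A_seminorm A (?P x))\<^sup>2 \<le> (A_norm A ?P)\<^sup>2" "(A_seminorm A (?M x))\<^sup>2 \<le> (A_norm A ?M)\<^sup>2"
    using p(2)[of x] m(2)[of x] x by (auto intro!: power_mono)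
  with A_norm_Re_pm_Im_power2_le[OF T] show ?thesis
    using A_seminorm_parallelogram[of "A_Re A T x" "A_Im A T x"]
    unfolding seminorm_sum_squares by (simp add: abs_if)
qed

lemma product_form_bound:
  assumes T: "T \<in> A_ops A" and X: "X \<in> A_ops A" and Y: "Y \<in> A_ops A"
    and R: "(A_seminorm A (T x))\<^sup>2 + (A_seminorm A (A_adjoint A T x))\<^sup>2 \<le> 4 * R"
    and x: "A_seminorm A x = 1"
  shows "cmod (A_inner A (T (X x)) x) + cmod (A_inner A (Y (T x)) x)
    \<le> 2 * sqrt 2 * max (A_norm A X) (A_norm A Y) * sqrt R"
proof -
  note pT = adjoint_pair_A_adjoint[OF T] and pX = adjoint_pair_A_adjoint[OF X]
    and pY = adjoint_pair_A_adjoint[OF Y]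
  define a b M where "a = A_seminorm A (T x)" and "b = A_seminorm A (A_adjoint A T x)"
    and "M = max (A_norm A X) (A_norm A Y)"
  have nn: "0 \<le> a" "0 \<le> b" "0 \<le> M"
    using A_norm_nonneg_and_bound(1)[OF pX] by (auto simp: a_def b_def M_def)
  have "cmod (A_inner A (T (X x)) x) \<le> A_seminorm A (X x) * b"
    using A_inner_bound[of "X x" "A_adjoint A T x"] by (simp add: adjoint_pairD(3)[OF pT] b_def)
  also have "\<dots> \<le> M * b"
    using A_norm_nonneg_and_bound(2)[OF pX, of x] x nn by (intro mult_right_mono) (auto simp: M_def)
  finally have TX: "cmod (A_inner A (T (X x)) x) \<le> M * b" .
  have "cmod (A_inner A (Y (T x)) x) \<le> a * A_seminorm A (A_adjoint A Y x)"
    using A_inner_bound[of "T x" "A_adjoint A Y x"] by (simp add: adjoint_pairD(3)[OF pY] a_def)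
  also have "\<dots> \<le> a * M"
    using A_seminorm_adjoint_le[OF pY, of x] x nn by (intro mult_left_mono) (auto simp: M_def)
  finally have YT: "cmod (A_inner A (Y (T x)) x) \<le> M * a" by (simp add: mult.commute)
  have "(a + b)\<^sup>2 \<le> 2 * (a\<^sup>2 + b\<^sup>2)"
    using zero_le_power2[of "a - b"] by (simp add: power2_eq_square algebra_simps)
  also have "\<dots> \<le> 8 * R"
    using R by (simp add: a_def b_def)
  \<comment> \<open>The 8 is factored so that the root splits into 2 and
    \<open>sqrt 2\<close>.\<close>
  finally have "a + b \<le> sqrt (2\<^sup>2 * 2 * R)"
    by (intro real_le_rsqrt) simp
  also have "\<dots> = 2 * sqrt 2 * sqrt R"
    by (simp only: real_sqrt_mult real_sqrt_abs abs_numeral)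
  finally have "M * (a + b) \<le> M * (2 * sqrt 2 * sqrt R)"
    using nn(3) by (rule mult_left_mono)
  then show ?thesis
    using TX YT by (simp add: M_def[symmetric] algebra_simps)
qed

text \<open>The supremum includes 0, also when no unit vector exists, so the bound itself must be
  nonnegative; in HOL \<open>sqrt\<close> of a negative number is negative, whence
  \<open>0 \<le> R\<close>.\<close>

lemma num_radius_product_le:
  assumes T: "T \<in> A_ops A" and X: "X \<in> A_ops A" and Y: "Y \<in> A_ops A"
    and R: "\<And>x. A_seminorm A x = 1 \<Longrightarrow>
      (A_seminorm A (T x))\<^sup>2 + (A_seminorm A (A_adjoint A T x))\<^sup>2 \<le> 4 * R"
    and "0 \<le> R"
  shows "A_num_radius A (\<lambda>x. T (X x) + Y (T x)) \<le> 2 * sqrt 2 * max (A_norm A X) (A_norm A Y) * sqrt R"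
    "A_num_radius A (\<lambda>x. T (X x) - Y (T x)) \<le> 2 * sqrt 2 * max (A_norm A X) (A_norm A Y) * sqrt R"
proof -
  have "0 \<le> 2 * sqrt 2 * max (A_norm A X) (A_norm A Y) * sqrt R"
    using A_norm_nonneg_and_bound(1)[OF adjoint_pair_A_adjoint[OF X]] \<open>0 \<le> R\<close>
    by (intro mult_nonneg_nonneg) auto
  moreover have "cmod (A_inner A (T (X x) + Y (T x)) x) \<le> 2 * sqrt 2 * max (A_norm A X) (A_norm A Y) * sqrt R"
    "cmod (A_inner A (T (X x) - Y (T x)) x) \<le> 2 * sqrt 2 * max (A_norm A X) (A_norm A Y) * sqrt R"
    if "A_seminorm A x = 1" for x
    using order_trans[OF norm_triangle_ineq product_form_bound[OF T X Y R[OF that] that]]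
      order_trans[OF norm_triangle_ineq4 product_form_bound[OF T X Y R[OF that] that]]
    by (simp_all only: A_inner_simps)
  ultimately show "A_num_radius A (\<lambda>x. T (X x) + Y (T x)) \<le> 2 * sqrt 2 * max (A_norm A X) (A_norm A Y) * sqrt R"
    "A_num_radius A (\<lambda>x. T (X x) - Y (T x)) \<le> 2 * sqrt 2 * max (A_norm A X) (A_norm A Y) * sqrt R"
    by (simp_all only: A_num_radius_le)
qed

text \<open>Two nonnegative numbers below c differ by at most c. With c = w^2 and c = 2w^2 each
  subtracted term is at most w^2/2; this covers \<open>A = 0\<close> too, where no unit vector could
  supply the sign.\<close>

lemma radicands_nonneg:
  assumes T: "T \<in> A_ops A"
  shows "0 \<le> (A_num_radius A T)\<^sup>2 - \<bar>(A_norm A (A_Re A T))\<^sup>2 - (A_norm A (A_Im A T))\<^sup>2\<bar> / 2"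
    "0 \<le> (A_num_radius A T)\<^sup>2 - \<bar>(A_norm A (\<lambda>x. A_Re A T x + A_Im A T x))\<^sup>2
      - (A_norm A (\<lambda>x. A_Re A T x - A_Im A T x))\<^sup>2\<bar> / 4"
proof -
  have "\<bar>a - b\<bar> \<le> c" if "a \<le> c" "b \<le> c" "0 \<le> a" "0 \<le> b" for a b c :: real
    using that by (simp add: abs_if)
  note diff = this[OF _ _ zero_le_power2 zero_le_power2]
  show "0 \<le> (A_num_radius A T)\<^sup>2 - \<bar>(A_norm A (A_Re A T))\<^sup>2 - (A_norm A (A_Im A T))\<^sup>2\<bar> / 2"
    using diff[OF A_norm_Re_Im_power2_le[OF T]] zero_le_power2[of "A_num_radius A T"] by simp
  show "0 \<le> (A_num_radius A T)\<^sup>2 - \<bar>(A_norm A (\<lambda>x. A_Re A T x + A_Im A T x))\<^sup>2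
      - (A_norm A (\<lambda>x. A_Re A T x - A_Im A T x))\<^sup>2\<bar> / 4"
    using diff[OF A_norm_Re_pm_Im_power2_le[OF T]] zero_le_power2[of "A_num_radius A T"] by simp
qed

end

theorem theorem3p2:
  fixes A T X Y :: "'a::chilbert_space \<Rightarrow> 'a"
  assumes "positive_op A"
    and "T \<in> A_ops A" and "X \<in> A_ops A" and "Y \<in> A_ops A"
  shows
    "A_num_radius A (\<lambda>x. T (X x) + Y (T x)) \<le>
       2 * sqrt 2 * max (A_norm A X) (A_norm A Y) *
       sqrt ((A_num_radius A T)\<^sup>2 - \<bar>(A_norm A (A_Re A T))\<^sup>2 - (A_norm A (A_Im A T))\<^sup>2\<bar> / 2)
    \<and> A_num_radius A (\<lambda>x. T (X x) - Y (T x)) \<le>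
       2 * sqrt 2 * max (A_norm A X) (A_norm A Y) *
       sqrt ((A_num_radius A T)\<^sup>2 - \<bar>(A_norm A (A_Re A T))\<^sup>2 - (A_norm A (A_Im A T))\<^sup>2\<bar> / 2)
    \<and> A_num_radius A (\<lambda>x. T (X x) + Y (T x)) \<le>
       2 * sqrt 2 * max (A_norm A X) (A_norm A Y) *
       sqrt ((A_num_radius A T)\<^sup>2 -
         \<bar>(A_norm A (\<lambda>x. A_Re A T x + A_Im A T x))\<^sup>2 - (A_norm A (\<lambda>x. A_Re A T x - A_Im A T x))\<^sup>2\<bar> / 4)
    \<and> A_num_radius A (\<lambda>x. T (X x) - Y (T x)) \<le>
       2 * sqrt 2 * max (A_norm A X) (A_norm A Y) *
       sqrt ((A_num_radius A T)\<^sup>2 -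
         \<bar>(A_norm A (\<lambda>x. A_Re A T x + A_Im A T x))\<^sup>2 - (A_norm A (\<lambda>x. A_Re A T x - A_Im A T x))\<^sup>2\<bar> / 4)"
proof -
  interpret positive_operator A
    using assms(1) by unfold_locales
  note T = assms(2) and bound = num_radius_product_le[OF assms(2-4)]
  show ?thesis
    using bound[OF seminorm_sum_squares_Re_Im[OF T] radicands_nonneg(1)[OF T]]
      bound[OF seminorm_sum_squares_Re_pm_Im[OF T] radicands_nonneg(2)[OF T]]
    by blast
qed

end
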